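(* Let $X=(X_1,\dots,X_d)$ be a random vector with distribution $F$ on $\mathbb{R}^d$, let $\|\cdot\|$ be any norm on $\mathbb{R}^d$, let $E$ be a (symmetric) positive-definite $d\times d$ matrix, let $\rho>0$, and let $V\in \mathrm{RV}_{-\rho}$. Suppose that $F$ has a density $f$ and that there is a locally bounded function $\lambda:\mathbb{R}^d\setminus\{0\}\to(0,\infty)$ such that, for every $\epsilon>0$, $$\frac{f(t^E x)}{t^{-\mathrm{tr}(E)}V(t)}\to \lambda(x)\quad\text{as } t\to\infty,$$ locally uniformly in $x\in\{x\in\mathbb{R}^d:\|x\|\ge \epsilon\}$. Then for every $\epsilon>0$ and every Borel subset $B\subseteq\{x\in\mathbb{R}^d:\|x\|\ge\epsilon\}$, $$\frac{\mathbb{P}(X\in t^E B)}{V(t)}\to\int_B\lambda(x)\,dx\quad\text{as } t\to\infty.$$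
   Context: For $\alpha\in\mathbb{R}$, $V\in\mathrm{RV}_{-\alpha}$ (univariate regular variation with tail index $-\alpha$) means that $V$ is a measurable function, positive for large argument, with $V(tx)/V(t)\to x^{-\alpha}$ as $t\to\infty$ for every $x>0$; functions in $\mathrm{RV}_0$ are called slowly varying. Throughout, the slowly varying functions involved are assumed continuous (that is, $t^{\alpha}V(t)$ is continuous for $V\in\mathrm{RV}_{-\alpha}$), and all functions and sets are assumed measurable. For a $d\times d$ matrix $A$ and $t>0$, the power matrix is $t^A=\exp(A\log t)=\sum_{k=0}^\infty A^k(\log t)^k/k!$. For $B\subseteq\mathbb{R}^d$, $t^EB=\{t^Ex:x\in B\}$. $\mathrm{tr}(E)$ is the trace of $E$. Locally uniformly means uniformly on compact subsets. *)

theory Defs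
  imports "HOL-Probability.Probability"
begin

(* V is viewed as a function on (0,\<infinity>); its values at t \<le> 0 are irrelevant.
   The index is signed: V \<in> RV (-\<rho>) means V(tx)/V(t) \<rightarrow> x powr (-\<rho>). *)
definition RV :: "real \<Rightarrow> (real \<Rightarrow> real) set" where
  "RV a = {V. V \<in> borel_measurable (restrict_space borel {0<..})
              \<and> (\<forall>\<^sub>F t in at_top. 0 < V t)
              \<and> (\<forall>x>0. ((\<lambda>t. V (t * x) / V t) \<longlongrightarrow> x powr a) at_top)}"

definition is_norm :: "('v::real_vector \<Rightarrow> real) \<Rightarrow> bool" where
  "is_norm N \<longleftrightarrow> (\<forall>x. 0 \<le> N x) \<and> (\<forall>x. N x = 0 \<longleftrightarrow> x = 0)
     \<and> (\<forall>c x. N (c *\<^sub>R x) = \<bar>c\<bar> * N x) \<and> (\<forall>x y. N (x + y) \<le> N x + N y)"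

definition sym_pos_def :: "real^'d^'d \<Rightarrow> bool" where
  "sym_pos_def A \<longleftrightarrow> transpose A = A \<and> (\<forall>x. x \<noteq> 0 \<longrightarrow> 0 < x \<bullet> (A *v x))"

(* The multiplication of the type class on vectors is componentwise,
   so powers of a matrix are built from the matrix product. *)
primrec matrix_pow :: "real^'d^'d \<Rightarrow> nat \<Rightarrow> real^'d^'d" where
  "matrix_pow A 0 = mat 1"
| "matrix_pow A (Suc k) = A ** matrix_pow A k"

(* t^A = exp (A log t), for t > 0 *)
definition power_matrix :: "real \<Rightarrow> real^'d^'d \<Rightarrow> real^'d^'d" where
  "power_matrix t A = (\<Sum>k. (ln t ^ k / fact k) *\<^sub>R matrix_pow A k)"

definition locally_bounded_on :: "'a::topological_space set \<Rightarrow> ('a \<Rightarrow> real) \<Rightarrow> bool" where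
  "locally_bounded_on S g \<longleftrightarrow> (\<forall>K. compact K \<and> K \<subseteq> S \<longrightarrow> bounded (g ` K))"

(* uniform convergence on the compact subsets of S *)
definition locally_uniform_limit ::
    "'a::topological_space set \<Rightarrow> ('i \<Rightarrow> 'a \<Rightarrow> real) \<Rightarrow> ('a \<Rightarrow> real) \<Rightarrow> 'i filter \<Rightarrow> bool" where
  "locally_uniform_limit S h g F \<longleftrightarrow>
     (\<forall>K. compact K \<and> K \<subseteq> S \<longrightarrow> uniform_limit K h g F)"

lemma matrix_pow_component_le:
  fixes A :: "real^'d^'d"
  assumes m: "\<And>i j. \<bar>A $ i $ j\<bar> \<le> m"
  shows "\<bar>matrix_pow A k $ i $ j\<bar> \<le> (real CARD('d) * m) ^ k"
proof (induction k arbitrary: i j)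
  case 0
  then show ?case by (simp add: mat_def)
next
  case (Suc k)
  have m0: "0 \<le> m" using m abs_ge_zero order_trans by blast
  have "\<bar>matrix_pow A (Suc k) $ i $ j\<bar> \<le> (\<Sum>l\<in>UNIV. \<bar>A $ i $ l * matrix_pow A k $ l $ j\<bar>)"
    by (simp add: matrix_matrix_mult_def sum_abs)
  also have "\<dots> \<le> (\<Sum>l\<in>(UNIV::'d set). m * (real CARD('d) * m) ^ k)"
    unfolding abs_mult by (intro sum_mono mult_mono m Suc.IH m0) auto
  finally show ?case by simp
qed

lemma summable_power_matrix:
  fixes A :: "real^'d^'d"
  shows "summable (\<lambda>k. (ln t ^ k / fact k) *\<^sub>R matrix_pow A k)"
proof -
  define m where "m = (\<Sum>i\<in>UNIV. \<Sum>j\<in>UNIV. \<bar>A $ i $ j\<bar>)"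
  have m: "\<bar>A $ i $ j\<bar> \<le> m" for i j
  proof -
    have "\<bar>A $ i $ j\<bar> \<le> (\<Sum>j\<in>UNIV. \<bar>A $ i $ j\<bar>)" by (rule member_le_sum) auto
    also have "\<dots> \<le> m" unfolding m_def
      by (rule member_le_sum[where f = "\<lambda>i. \<Sum>j\<in>UNIV. \<bar>A $ i $ j\<bar>"]) (auto intro: sum_nonneg)
    finally show ?thesis .
  qed
  define c where "c = real CARD('d) * m"
  have nrm: "norm (matrix_pow A k) \<le> real CARD('d) * (real CARD('d) * c ^ k)" for k
  proof -
    have "norm (matrix_pow A k) \<le> (\<Sum>i\<in>UNIV. norm (matrix_pow A k $ i))"
      by (simp add: norm_vec_def L2_set_le_sum)
    also have "\<dots> \<le> (\<Sum>i\<in>UNIV. \<Sum>j\<in>UNIV. \<bar>matrix_pow A k $ i $ j\<bar>)"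
      by (intro sum_mono norm_le_l1_cart)
    also have "\<dots> \<le> (\<Sum>i\<in>(UNIV::'d set). \<Sum>j\<in>(UNIV::'d set). c ^ k)"
      unfolding c_def by (intro sum_mono matrix_pow_component_le m)
    finally show ?thesis by simp
  qed
  have "summable (\<lambda>k. (real CARD('d))\<^sup>2 * ((\<bar>ln t\<bar> * c) ^ k / fact k))"
    using summable_exp[of "\<bar>ln t\<bar> * c"]
    by (intro summable_mult) (simp add: divide_inverse mult.commute)
  moreover have "norm ((ln t ^ k / fact k) *\<^sub>R matrix_pow A k)
      \<le> (real CARD('d))\<^sup>2 * ((\<bar>ln t\<bar> * c) ^ k / fact k)" for k
    using mult_left_mono[OF nrm[of k], of "\<bar>ln t\<bar> ^ k / fact k"]
    by (simp add: power_abs power_mult_distrib power2_eq_square ac_simps)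
  ultimately show ?thesis
    by (rule summable_comparison_test'[where N = 0]) 
qed

end

theory Submission
  imports Defs
begin

text \<open>
  Put \<open>g t x = f (t\<^sup>E x) / (t powr (- trace E) * V t)\<close>. Since \<open>det (t\<^sup>E) = t powr trace E\<close>
  (\<open>det_power_matrix\<close>), a linear change of variables (\<open>measure_density_matrix_image\<close>) turns the
  probability of \<open>t\<^sup>E B\<close>, divided by \<open>V t\<close>, into the integral of \<open>g t\<close> over \<open>B\<close>. By hypothesis
  \<open>g t\<close> converges to the limit function at every point of \<open>B\<close>, so the theorem, including the
  integrability of the limit on \<open>B\<close>, follows by dominated convergence once all the \<open>g t\<close> with large
  \<open>t\<close> have a common integrable bound on \<open>B\<close>.

  The set \<open>B\<close> may be unbounded, and the convergence is uniform on compact sets only. A bound at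
  infinity comes from scaling. Let \<open>C\<close> be the compact shell between the sphere of radius \<open>\<delta>\<close>
  around the origin and its image under \<open>2\<^sup>E\<close>. As \<open>E\<close> is positive definite, \<open>2\<^sup>-\<^sup>n\<^sup>E x\<close> tends
  to \<open>0\<close>, so the dilated shells \<open>2\<^sup>n\<^sup>E C\<close> cover everything outside the ball of radius
  \<open>\<delta>\<close> (\<open>dilated_shells_cover\<close>). For \<open>y\<close> in \<open>C\<close>,

    \<open>g t (2\<^sup>n\<^sup>E y) = g (2\<^sup>n t) y * 2 powr (- n * trace E) * V (2\<^sup>n t) / V t\<close>.

  The first factor is bounded on \<open>C\<close>, uniformly at all large scales. As \<open>V\<close> is regularly varying
  of negative index, the last ratio is at most \<open>q\<^sup>n\<close> for some \<open>q < 1\<close>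
  (\<open>regularly_varying_geometric_decay\<close>). So \<open>g t\<close> is at most a constant times
  \<open>q\<^sup>n 2 powr (- n * trace E)\<close> on the \<open>n\<close>-th dilated shell
  (\<open>rescaled_density_le_on_dilated_shells\<close>), a set of volume \<open>2 powr (n * trace E)\<close> times that
  of \<open>C\<close>. The sum of these bounds has a geometric series as its integral
  (\<open>integrable_geometric_weight_on_dilated_shells\<close>).
\<close>

section \<open>Linear change of variables for Lebesgue measure\<close>

text \<open>
  The formula \<open>measure_linear_image\<close> for the volume of a linear image presupposes an order on the
  index type, because elimination by elementary matrices treats the coordinates one after another.
  Neither volume nor determinant depends on that order. So for an arbitrary finite index type the
  coordinates are relabelled by a copy of the type on which some order is chosen.
\<close>

typedef ('a::finite) well_ordered = "UNIV :: 'a set"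
  by simp

instantiation well_ordered :: (finite) "{finite, wellorder}"
begin

definition less_eq_well_ordered :: "'a well_ordered \<Rightarrow> 'a well_ordered \<Rightarrow> bool" where
  "x \<le> y \<longleftrightarrow> to_nat (Rep_well_ordered x) \<le> to_nat (Rep_well_ordered y)"

definition less_well_ordered :: "'a well_ordered \<Rightarrow> 'a well_ordered \<Rightarrow> bool" where
  "x < y \<longleftrightarrow> to_nat (Rep_well_ordered x) < to_nat (Rep_well_ordered y)"

instance
proof
  show "finite (UNIV :: 'a well_ordered set)"
    using type_definition.univ[OF type_definition_well_ordered] by (metis finite finite_imageI)
next
  fix P :: "'a well_ordered \<Rightarrow> bool" and x
  assume step: "\<And>x. (\<And>y. y < x \<Longrightarrow> P y) \<Longrightarrow> P x"
  show "P x"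
  proof (induction x rule: measure_induct_rule[of "\<lambda>x. to_nat (Rep_well_ordered x)"])
    case (less x)
    show ?case
      by (rule step, rule less.IH) (simp add: less_well_ordered_def)
  qed
qed (auto simp: less_eq_well_ordered_def less_well_ordered_def Rep_well_ordered_inject)

end

lemma bij_Rep_well_ordered: "bij Rep_well_ordered"
  by (metis Abs_well_ordered_inverse Rep_well_ordered_inverse UNIV_I bijI')

text \<open>
  Conjugation by a bijection of the index types is a sign-preserving bijection of permutations, and it
  matches the terms of the two Leibniz sums.
\<close>

lemma det_reindex:
  fixes A :: "'a::comm_ring_1^'n^'n" and \<sigma> :: "'m::finite \<Rightarrow> 'n"
  assumes \<sigma>: "bij \<sigma>"
  shows "det (\<chi> i j. A $ \<sigma> i $ \<sigma> j) = det A"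
proof -
  let ?P = "\<lambda>S. {p. p permutes S}"
  have "bij_betw (map_permutation UNIV \<sigma>) (?P UNIV) (?P UNIV)"
    using bij_betw_permutations[OF \<sigma>] by (simp add: map_permutation_def[abs_def] restrict_id_def bij_is_surj[OF \<sigma>])
  then have "det A = (\<Sum>p\<in>?P UNIV. of_int (sign (map_permutation UNIV \<sigma> p)) *
      (\<Prod>i\<in>UNIV. A $ i $ map_permutation UNIV \<sigma> p i))"
    unfolding det_def by (rule sum.reindex_bij_betw[symmetric])
  also have "\<dots> = (\<Sum>p\<in>?P UNIV. of_int (sign p) * (\<Prod>i\<in>UNIV. A $ \<sigma> i $ \<sigma> (p i)))"
  proof (rule sum.cong)
    fix p :: "'m \<Rightarrow> 'm" assume p: "p \<in> ?P UNIV"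
    have "(\<Prod>i\<in>UNIV. A $ i $ map_permutation UNIV \<sigma> p i)
        = (\<Prod>i\<in>UNIV. A $ \<sigma> i $ map_permutation UNIV \<sigma> p (\<sigma> i))"
      using \<sigma> by (rule prod.reindex_bij_betw[symmetric])
    then show "of_int (sign (map_permutation UNIV \<sigma> p)) * (\<Prod>i\<in>UNIV. A $ i $ map_permutation UNIV \<sigma> p i)
        = of_int (sign p) * (\<Prod>i\<in>UNIV. A $ \<sigma> i $ \<sigma> (p i))"
      using p \<sigma> by (simp add: sign_map_permutation bij_is_inj map_permutation_apply)
  qed simp
  finally show ?thesis by (simp add: det_def)
qed

lemma emeasure_lborel_box_cart:
  fixes l u :: "real^'n"
  assumes "\<And>i. l $ i \<le> u $ i"
  shows "emeasure lborel (box l u) = ennreal (\<Prod>i\<in>UNIV. u $ i - l $ i)"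
proof -
  have "\<And>b. b \<in> Basis \<Longrightarrow> l \<bullet> b \<le> u \<bullet> b"
    using assms by (auto simp: Basis_vec_def inner_axis)
  then have "emeasure lborel (box l u) = emeasure lborel (cbox l u)"
    by simp
  also have "\<dots> = ennreal (measure lborel (cbox l u))"
    using emeasure_lborel_cbox_finite[of l u] by (intro emeasure_eq_ennreal_measure) simp
  also have "measure lborel (cbox l u) = (\<Prod>i\<in>UNIV. u $ i - l $ i)"
    using assms by (intro content_cbox_cart) (simp add: interval_ne_empty_cart)
  finally show ?thesis .
qed

lemma lborel_eqI_cart:
  fixes M :: "(real^'n) measure"
  assumes "\<And>l u. (\<And>i. l $ i \<le> u $ i) \<Longrightarrow> emeasure M (box l u) = ennreal (\<Prod>i\<in>UNIV. u $ i - l $ i)"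
    and "sets M = sets borel"
  shows "lborel = M"
proof (rule lborel_eqI)
  fix l u :: "real^'n" assume le: "\<And>b. b \<in> Basis \<Longrightarrow> l \<bullet> b \<le> u \<bullet> b"
  then have "l $ i \<le> u $ i" for i
    using le[of "axis i 1"] by (simp add: inner_axis axis_in_Basis_iff)
  with le show "emeasure M (box l u) = ennreal (\<Prod>b\<in>Basis. (u - l) \<bullet> b)"
    using emeasure_lborel_box[of l u] emeasure_lborel_box_cart[of l u] by (simp add: assms)
qed (use assms in simp)

text \<open>
  Relabelling the coordinates turns boxes into boxes with the same side lengths, and boxes determine
  Lebesgue measure.
\<close>

lemma distr_lborel_reindex:
  fixes \<sigma> :: "'m::finite \<Rightarrow> 'n::finite"
  assumes \<sigma>: "bij \<sigma>"
  shows "distr lborel borel (\<lambda>x::real^'n. \<chi> i. x $ \<sigma> i) = lborel"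
proof (rule lborel_eqI_cart[symmetric])
  fix l u :: "real^'m" assume le: "\<And>i. l $ i \<le> u $ i"
  have meas: "(\<lambda>x::real^'n. \<chi> i. x $ \<sigma> i) \<in> borel_measurable borel"
    by (intro borel_measurable_continuous_onI continuous_intros)
  have "(\<lambda>x::real^'n. \<chi> i. x $ \<sigma> i) -` box l u = box (\<chi> j. l $ inv \<sigma> j) (\<chi> j. u $ inv \<sigma> j)"
    using \<sigma> by (auto simp: mem_box_cart bij_is_inj bij_is_surj surj_f_inv_f)
      (metis bij_inv_eq_iff)+
  then have "emeasure (distr lborel borel (\<lambda>x::real^'n. \<chi> i. x $ \<sigma> i)) (box l u)
      = ennreal (\<Prod>j\<in>UNIV. u $ inv \<sigma> j - l $ inv \<sigma> j)"
    using meas le by (simp add: emeasure_distr emeasure_lborel_box_cart)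
  also have "(\<Prod>j\<in>UNIV. u $ inv \<sigma> j - l $ inv \<sigma> j) = (\<Prod>i\<in>UNIV. u $ i - l $ i)"
    using prod.reindex_bij_betw[OF bij_imp_bij_inv[OF \<sigma>]] .
  finally show "emeasure (distr lborel borel (\<lambda>x::real^'n. \<chi> i. x $ \<sigma> i)) (box l u)
      = ennreal (\<Prod>i\<in>UNIV. u $ i - l $ i)" .
qed simp

lemma measurable_matrix_vector_mult [measurable]:
  "(\<lambda>x. A *v x) \<in> borel_measurable (borel :: (real^'n) measure)"
  by (intro borel_measurable_continuous_onI linear_continuous_on matrix_vector_mul_bounded_linear)

text \<open>
  Let \<open>\<Phi>\<close> relabel the coordinates by the well-ordered copy. It conjugates \<open>A\<close> to the relabelled
  matrix \<open>A'\<close> and preserves volumes and determinants, so the formula for \<open>A'\<close> is the formula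
  for \<open>A\<close>. Boxes are enough, because they determine the measure in the next lemma.
\<close>

lemma emeasure_lborel_matrix_image_box:
  fixes A :: "real^'n^'n"
  assumes A: "det A \<noteq> 0" and le: "\<And>i. l $ i \<le> u $ i"
  shows "emeasure lborel ((*v) A ` box l u) = ennreal (\<bar>det A\<bar> * (\<Prod>i\<in>UNIV. u $ i - l $ i))"
proof -
  define \<sigma> where "\<sigma> = (Rep_well_ordered :: 'n well_ordered \<Rightarrow> 'n)"
  have \<sigma>: "bij \<sigma>" unfolding \<sigma>_def by (rule bij_Rep_well_ordered)
  define \<Phi> where "\<Phi> x = (\<chi> i. x $ \<sigma> i)" for x :: "real^'n"
  define A' where "A' = (\<chi> i j. A $ \<sigma> i $ \<sigma> j)"
  let ?l = "\<Phi> l" and ?u = "\<Phi> u"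
  have A'\<Phi>: "A' *v \<Phi> x = \<Phi> (A *v x)" for x
    using sum.reindex_bij_betw[OF \<sigma>, of "\<lambda>j. A $ \<sigma> i $ j * x $ j" for i]
    by (simp add: A'_def \<Phi>_def matrix_vector_mult_def vec_eq_iff)
  have bij: "bij \<Phi>"
    unfolding bij_def inj_def surj_def \<Phi>_def using \<sigma>
    by (auto simp: vec_eq_iff intro!: exI[of _ "\<chi> j. _ $ inv \<sigma> j"] simp: bij_is_inj)
      (metis bij_inv_eq_iff)
  have box: "\<Phi> ` box l u = box ?l ?u"
  proof -
    have "x \<in> box l u \<longleftrightarrow> \<Phi> x \<in> box ?l ?u" for x
      unfolding \<Phi>_def using \<sigma> by (auto simp: mem_box_cart) (metis bij_inv_eq_iff)+
    then have "box l u = \<Phi> -` box ?l ?u" by blast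
    then show ?thesis using surj_image_vimage_eq[OF bij_is_surj[OF bij]] by simp
  qed
  have meas: "\<Phi> \<in> borel_measurable borel"
    unfolding \<Phi>_def by (intro borel_measurable_continuous_onI continuous_intros)
  have det: "det A' = det A" unfolding A'_def by (rule det_reindex[OF \<sigma>])
  have "(*v) A' ` box ?l ?u = \<Phi> ` (*v) A ` box l u"
    by (simp add: box[symmetric] image_image A'\<Phi>)
  then have pre: "\<Phi> -` (*v) A' ` box ?l ?u = (*v) A ` box l u"
    using bij by (simp add: inj_vimage_image_eq bij_is_inj)
  have lm: "(*v) A' ` box ?l ?u \<in> lmeasurable"
    by (intro measurable_linear_image) auto
  have "open ((*v) A' ` box ?l ?u)"
    using A invertible_det_nz[of A'] unfolding det
    by (intro open_surjective_linear_image open_box)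
      (simp_all add: invertible_eq_bij bij_is_surj)
  then have b: "(*v) A' ` box ?l ?u \<in> sets borel" by simp
  have "emeasure lborel ((*v) A ` box l u) = emeasure (distr lborel borel \<Phi>) ((*v) A' ` box ?l ?u)"
    using meas b by (simp add: emeasure_distr pre)
  also have "\<dots> = emeasure lborel ((*v) A' ` box ?l ?u)"
    using distr_lborel_reindex[OF \<sigma>] by (simp add: \<Phi>_def[abs_def])
  also have "\<dots> = emeasure lebesgue ((*v) A' ` box ?l ?u)"
    using b by simp
  also have "\<dots> = ennreal (measure lebesgue ((*v) A' ` box ?l ?u))"
    using lm by (rule emeasure_eq_measure2)
  also have "measure lebesgue ((*v) A' ` box ?l ?u) = \<bar>det A'\<bar> * measure lebesgue (box ?l ?u)"
    by (subst measure_linear_image) auto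
  also note det
  also have "measure lebesgue (box ?l ?u) = (\<Prod>i\<in>UNIV. u $ i - l $ i)"
  proof -
    have "(\<Prod>i\<in>UNIV. u $ \<sigma> i - l $ \<sigma> i) = (\<Prod>i\<in>UNIV. u $ i - l $ i)"
      using \<sigma> by (rule prod.reindex_bij_betw)
    moreover have "measure lebesgue (box ?l ?u) = measure lborel (box ?l ?u)"
      by (rule measure_completion) simp
    moreover have "0 \<le> (\<Prod>i\<in>UNIV. u $ i - l $ i)"
      using le by (intro prod_nonneg) simp
    ultimately show ?thesis
      using emeasure_lborel_box_cart[of ?l ?u] le by (simp add: \<Phi>_def measure_def)
  qed
  finally show ?thesis .
qed

text \<open>
  The image of Lebesgue measure under \<open>A\<close> assigns to a box the volume of its image under the inverse
  \<open>B\<close>, that is, \<open>\<bar>det B\<bar> = 1 / \<bar>det A\<bar>\<close> times the volume of the box. With density \<open>\<bar>det A\<bar>\<close> it is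
  therefore Lebesgue measure itself.
\<close>

lemma nn_integral_lborel_matrix_vector_mult:
  fixes A :: "real^'n^'n"
  assumes A: "det A \<noteq> 0" and g: "g \<in> borel_measurable borel"
  shows "(\<integral>\<^sup>+x. g x \<partial>lborel) = ennreal \<bar>det A\<bar> * (\<integral>\<^sup>+x. g (A *v x) \<partial>lborel)"
proof -
  have "invertible A" using A by (simp add: invertible_det_nz)
  then obtain B where AB: "A ** B = mat 1" "B ** A = mat 1"
    unfolding invertible_def by blast
  have detAB: "det A * det B = 1"
    using det_mul[of A B] by (simp add: AB)
  have "lborel = density (distr lborel borel ((*v) A)) (\<lambda>_. ennreal \<bar>det A\<bar>)"
  proof (rule lborel_eqI_cart)
    fix l u :: "real^'n" assume le: "\<And>i. l $ i \<le> u $ i"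
    have "(*v) A -` box l u = (*v) B ` box l u"
    proof -
      have "A *v (B *v x) = x" "B *v (A *v x) = x" for x
        by (simp_all add: matrix_vector_mul_assoc AB)
      then show ?thesis
        by (auto simp: image_iff) metis
    qed
    moreover have "det B \<noteq> 0" using detAB by auto
    ultimately have "emeasure (density (distr lborel borel ((*v) A)) (\<lambda>_. ennreal \<bar>det A\<bar>)) (box l u)
        = ennreal \<bar>det A\<bar> * ennreal (\<bar>det B\<bar> * (\<Prod>i\<in>UNIV. u $ i - l $ i))"
      by (simp add: emeasure_density_const emeasure_distr
          emeasure_lborel_matrix_image_box[OF _ le])
    also have "\<dots> = ennreal (\<Prod>i\<in>UNIV. u $ i - l $ i)"
    proof -
      have "\<bar>det A\<bar> * \<bar>det B\<bar> = 1" using detAB by (metis abs_mult abs_one)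
      then have "\<bar>det A\<bar> * (\<bar>det B\<bar> * p) = p" for p
        by (simp only: mult.assoc[symmetric] mult_1)
      moreover have "ennreal \<bar>det A\<bar> * ennreal (\<bar>det B\<bar> * p) = ennreal (\<bar>det A\<bar> * (\<bar>det B\<bar> * p))" for p
        by (rule ennreal_mult'[symmetric]) simp
      ultimately show ?thesis by (simp only:)
    qed
    finally show "emeasure (density (distr lborel borel ((*v) A)) (\<lambda>_. ennreal \<bar>det A\<bar>)) (box l u)
        = ennreal (\<Prod>i\<in>UNIV. u $ i - l $ i)" .
  qed simp
  then have "(\<integral>\<^sup>+x. g x \<partial>lborel)
      = (\<integral>\<^sup>+x. g x \<partial>density (distr lborel borel ((*v) A)) (\<lambda>_. ennreal \<bar>det A\<bar>))"
    by (rule arg_cong[where f = "\<lambda>M. integral\<^sup>N M g"])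
  also have "\<dots> = ennreal \<bar>det A\<bar> * (\<integral>\<^sup>+x. g (A *v x) \<partial>lborel)"
    using g by (simp add: nn_integral_density nn_integral_cmult nn_integral_distr)
  finally show ?thesis .
qed

lemma sets_borel_matrix_image:
  fixes A :: "real^'d^'d"
  assumes A: "det A \<noteq> 0" and B: "B \<in> sets borel"
  shows "(*v) A ` B \<in> sets borel"
proof -
  have "invertible A" using A by (simp add: invertible_det_nz)
  then obtain A' where A': "A ** A' = mat 1" "A' ** A = mat 1"
    unfolding invertible_def by blast
  have "A *v (A' *v x) = x" "A' *v (A *v x) = x" for x
    by (simp_all add: matrix_vector_mul_assoc A')
  then have "(*v) A ` B = (*v) A' -` B" by (auto simp: image_iff) metis
  then show ?thesis
    using measurable_sets[OF measurable_matrix_vector_mult[of A'] B] by simp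
qed

lemma set_nn_integral_matrix_image:
  fixes A :: "real^'d^'d"
  assumes A: "det A \<noteq> 0" and g: "g \<in> borel_measurable borel" and B: "B \<in> sets borel"
  shows "(\<integral>\<^sup>+x. g x * indicator ((*v) A ` B) x \<partial>lborel)
    = ennreal \<bar>det A\<bar> * (\<integral>\<^sup>+x. g (A *v x) * indicator B x \<partial>lborel)"
proof -
  have "invertible A" using A by (simp add: invertible_det_nz)
  then have inj: "inj ((*v) A)" by (simp add: invertible_eq_bij bij_is_inj)
  have "(\<integral>\<^sup>+x. g x * indicator ((*v) A ` B) x \<partial>lborel)
      = ennreal \<bar>det A\<bar> * (\<integral>\<^sup>+x. g (A *v x) * indicator ((*v) A ` B) (A *v x) \<partial>lborel)"
    by (intro nn_integral_lborel_matrix_vector_mult A borel_measurable_times_ennreal g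
        borel_measurable_indicator sets_borel_matrix_image B)
  also have "(\<integral>\<^sup>+x. g (A *v x) * indicator ((*v) A ` B) (A *v x) \<partial>lborel)
      = (\<integral>\<^sup>+x. g (A *v x) * indicator B x \<partial>lborel)"
    using inj by (intro nn_integral_cong) (auto simp: indicator_def inj_image_mem_iff)
  finally show ?thesis .
qed

lemma emeasure_lborel_matrix_image:
  fixes A :: "real^'d^'d"
  assumes A: "det A \<noteq> 0" and B: "B \<in> sets borel"
  shows "emeasure lborel ((*v) A ` B) = ennreal \<bar>det A\<bar> * emeasure lborel B"
  using set_nn_integral_matrix_image[OF A, of "\<lambda>_. 1" B] B sets_borel_matrix_image[OF A B] by simp

lemma measure_density_matrix_image:
  fixes A :: "real^'d^'d"
  assumes A: "det A \<noteq> 0" and f: "f \<in> borel_measurable borel" "\<And>x. 0 \<le> f x" and B: "B \<in> sets borel"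
  shows "measure (density lborel (\<lambda>x. ennreal (f x))) ((*v) A ` B)
    = \<bar>det A\<bar> * (LINT x:B|lborel. f (A *v x))"
proof -
  have fA: "(\<lambda>x. f (A *v x)) \<in> borel_measurable borel"
    by (rule measurable_compose[OF measurable_matrix_vector_mult f(1)])
  have "emeasure (density lborel (\<lambda>x. ennreal (f x))) ((*v) A ` B)
      = (\<integral>\<^sup>+x. ennreal (f x) * indicator ((*v) A ` B) x \<partial>lborel)"
    using f sets_borel_matrix_image[OF A B] by (intro emeasure_density) auto
  also have "\<dots> = ennreal \<bar>det A\<bar> * (\<integral>\<^sup>+x. ennreal (f (A *v x)) * indicator B x \<partial>lborel)"
    using f(1) by (intro set_nn_integral_matrix_image A B) simp
  also have "(\<integral>\<^sup>+x. ennreal (f (A *v x)) * indicator B x \<partial>lborel)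
      = (\<integral>\<^sup>+x. ennreal (indicator B x *\<^sub>R f (A *v x)) \<partial>lborel)"
    by (intro nn_integral_cong) (auto simp: indicator_def)
  finally have "measure (density lborel (\<lambda>x. ennreal (f x))) ((*v) A ` B)
      = \<bar>det A\<bar> * enn2real (\<integral>\<^sup>+x. ennreal (indicator B x *\<^sub>R f (A *v x)) \<partial>lborel)"
    by (simp add: measure_def enn2real_mult)
  also have "enn2real (\<integral>\<^sup>+x. ennreal (indicator B x *\<^sub>R f (A *v x)) \<partial>lborel)
      = (LINT x:B|lborel. f (A *v x))"
    unfolding set_lebesgue_integral_def using fA B f(2)
    by (intro integral_eq_nn_integral[symmetric]) auto
  finally show ?thesis .
qed

section \<open>The matrix exponential and its determinant\<close>

lemma matrix_pow_add: "matrix_pow A (m + n) = matrix_pow A m ** matrix_pow A n"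
  by (induction m) (simp_all add: matrix_mul_assoc)

text \<open>
  The family \<open>t\<^sup>A\<close> in additive time: \<open>t = exp s\<close> turns the multiplicative group of dilations into a
  one-parameter group that solves a linear differential equation.
\<close>

definition matrix_exp :: "real^'d^'d \<Rightarrow> real \<Rightarrow> real^'d^'d" where
  "matrix_exp A s = power_matrix (exp s) A"

lemma power_matrix_eq_matrix_exp: "t > 0 \<Longrightarrow> power_matrix t A = matrix_exp A (ln t)"
  by (simp add: matrix_exp_def)

lemma matrix_exp_component_sums:
  "(\<lambda>k. matrix_pow A k $ i $ j / fact k * s ^ k) sums (matrix_exp A s $ i $ j)"
proof -
  have "(\<lambda>k. (s ^ k / fact k) *\<^sub>R matrix_pow A k) sums matrix_exp A s"
    using summable_power_matrix[of "exp s" A]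
    by (simp add: matrix_exp_def power_matrix_def summable_sums)
  from bounded_linear.sums[OF bounded_linear_vec_nth, OF bounded_linear.sums[OF bounded_linear_vec_nth, OF this]]
  show ?thesis by (simp add: mult_ac)
qed

lemma matrix_exp_component_abs_summable:
  "summable (\<lambda>k. norm (matrix_pow A k $ i $ j / fact k * s ^ k))"
  by (rule powser_insidea[where x = "\<bar>s\<bar> + 1"])
    (use matrix_exp_component_sums[of A i j "\<bar>s\<bar> + 1"] in \<open>auto simp: sums_iff\<close>)

lemma matrix_exp_0: "matrix_exp A 0 = mat 1"
proof -
  have "matrix_exp A 0 $ i $ j = mat 1 $ i $ j" for i j
    using sums_unique2[OF matrix_exp_component_sums[of A i j 0], of "mat 1 $ i $ j"]
      sums_single[of 0 "\<lambda>k. matrix_pow A k $ i $ j"]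
    by (auto simp: power_0_left if_distrib cong: if_cong)
  then show ?thesis by (simp add: vec_eq_iff)
qed

text \<open>
  Entrywise, this is the Cauchy product of the two exponential series: the terms of total
  degree \<open>k\<close> all contain the power \<open>A\<^sup>k\<close>, and the binomial theorem adds up their coefficients.
\<close>

lemma matrix_exp_add: "matrix_exp A (s + t) = matrix_exp A s ** matrix_exp A t"
proof -
  have "matrix_exp A (s + t) $ i $ j = (matrix_exp A s ** matrix_exp A t) $ i $ j" for i j
  proof -
    define a where "a l k = matrix_pow A k $ i $ l / fact k * s ^ k" for l k
    define b where "b l k = matrix_pow A k $ l $ j / fact k * t ^ k" for l k
    have "(\<lambda>k. \<Sum>m\<le>k. a l m * b l (k - m)) sums (matrix_exp A s $ i $ l * matrix_exp A t $ l $ j)" for l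
      using Cauchy_product_sums[of "a l" "b l"] matrix_exp_component_abs_summable[of A]
        matrix_exp_component_sums[of A, THEN sums_unique]
      by (simp add: a_def b_def)
    then have "(\<lambda>k. \<Sum>l\<in>UNIV. \<Sum>m\<le>k. a l m * b l (k - m)) sums (matrix_exp A s ** matrix_exp A t) $ i $ j"
      unfolding matrix_matrix_mult_def by (auto intro: sums_sum)
    moreover have "(\<Sum>l\<in>UNIV. \<Sum>m\<le>k. a l m * b l (k - m)) = matrix_pow A k $ i $ j / fact k * (s + t) ^ k" for k
    proof -
      have "(\<Sum>l\<in>UNIV. \<Sum>m\<le>k. a l m * b l (k - m)) = (\<Sum>m\<le>k. \<Sum>l\<in>UNIV. a l m * b l (k - m))"
        by (rule sum.swap)
      also have "\<dots> = (\<Sum>m\<le>k. matrix_pow A k $ i $ j / fact k * (of_nat (k choose m) * s ^ m * t ^ (k - m)))"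
      proof (rule sum.cong)
        fix m assume "m \<in> {..k}"
        then have m: "m \<le> k" by simp
        have "(\<Sum>l\<in>UNIV. a l m * b l (k - m)) =
            (\<Sum>l\<in>UNIV. matrix_pow A m $ i $ l * matrix_pow A (k - m) $ l $ j) * (s ^ m * t ^ (k - m) / (fact m * fact (k - m)))"
          unfolding sum_distrib_right by (rule sum.cong) (simp_all add: a_def b_def)
        also have "(\<Sum>l\<in>UNIV. matrix_pow A m $ i $ l * matrix_pow A (k - m) $ l $ j) = matrix_pow A k $ i $ j"
          using matrix_pow_add[of A m "k - m"] m by (simp add: matrix_matrix_mult_def)
        finally show "(\<Sum>l\<in>UNIV. a l m * b l (k - m)) =
            matrix_pow A k $ i $ j / fact k * (of_nat (k choose m) * s ^ m * t ^ (k - m))"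
          using m by (simp add: binomial_fact)
      qed simp
      also have "\<dots> = matrix_pow A k $ i $ j / fact k * (s + t) ^ k"
        by (simp add: binomial_ring sum_distrib_left)
      finally show ?thesis .
    qed
    ultimately show ?thesis
      using sums_unique2[OF matrix_exp_component_sums] by simp
  qed
  then show ?thesis by (simp add: vec_eq_iff)
qed

lemma has_derivative_matrix_exp_component:
  "((\<lambda>s. matrix_exp A s $ i $ j) has_real_derivative (A ** matrix_exp A s) $ i $ j) (at s)"
proof -
  define c where "c k = matrix_pow A k $ i $ j / fact k" for k
  have "((\<lambda>s. \<Sum>k. c k * s ^ k) has_real_derivative (\<Sum>k. diffs c k * s ^ k)) (at s)"
    using matrix_exp_component_sums[of A i j, THEN sums_summable]
    by (intro termdiffs_strong_converges_everywhere) (simp add: c_def)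
  moreover have "(\<Sum>k. c k * s ^ k) = matrix_exp A s $ i $ j" for s
    using matrix_exp_component_sums[of A i j s] by (simp add: c_def sums_iff)
  moreover have "(\<lambda>k. diffs c k * s ^ k) sums (A ** matrix_exp A s) $ i $ j"
  proof -
    have "(\<lambda>k. \<Sum>l\<in>UNIV. A $ i $ l * (matrix_pow A k $ l $ j / fact k * s ^ k))
        sums (\<Sum>l\<in>UNIV. A $ i $ l * matrix_exp A s $ l $ j)"
      by (intro sums_sum sums_mult matrix_exp_component_sums)
    moreover have "(\<Sum>l\<in>UNIV. A $ i $ l * (matrix_pow A k $ l $ j / fact k * s ^ k)) = diffs c k * s ^ k" for k
      by (simp add: diffs_def c_def matrix_matrix_mult_def sum_distrib_left sum_divide_distrib
          sum_distrib_right mult_ac del: of_nat_Suc)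
    ultimately show ?thesis by (simp add: matrix_matrix_mult_def)
  qed
  ultimately show ?thesis by (simp add: sums_iff)
qed

text \<open>
  In the Leibniz formula at the identity matrix, a permutation other than the identity moves at least
  two points, so that its product has at least two vanishing factors and contributes nothing to the
  first order. Only the product of the diagonal entries is left.
\<close>

lemma det_has_derivative_trace_at_identity:
  fixes M :: "real \<Rightarrow> real^'d^'d"
  assumes M0: "M 0 = mat 1"
    and M': "\<And>i j. ((\<lambda>s. M s $ i $ j) has_real_derivative A $ i $ j) (at 0)"
  shows "((\<lambda>s. det (M s)) has_real_derivative trace A) (at 0)"
proof -
  let ?P = "{p. p permutes (UNIV :: 'd set)}"
  define D where "D p = (\<Sum>i\<in>(UNIV :: 'd set). A $ i $ p i * (\<Prod>j\<in>UNIV - {i}. M 0 $ j $ p j))" for p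
  have "((\<lambda>s. \<Prod>i\<in>UNIV. M s $ i $ p i) has_real_derivative D p) (at 0)" for p
    unfolding D_def by (rule has_field_derivative_prod) (rule M')
  then have "((\<lambda>s. det (M s)) has_real_derivative (\<Sum>p\<in>?P. of_int (sign p) * D p)) (at 0)"
    unfolding det_def by (intro DERIV_sum DERIV_cmult)
  moreover have "(\<Sum>p\<in>?P. of_int (sign p) * D p) = trace A"
  proof -
    have "D p = 0" if p: "p permutes UNIV" "p \<noteq> id" for p
    proof -
      have "\<exists>j. j \<noteq> i \<and> p j \<noteq> j" for i
      proof -
        obtain k where k: "p k \<noteq> k" using p(2) by (auto simp: fun_eq_iff)
        moreover have "p (p k) \<noteq> p k" using k permutes_inj[OF p(1)] by (auto dest: injD)
        ultimately show ?thesis by metis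
      qed
      then have "\<exists>j\<in>UNIV - {i}. M 0 $ j $ p j = 0" for i
      proof -
        obtain j where j: "j \<noteq> i" "p j \<noteq> j" using \<open>\<And>i. \<exists>j. j \<noteq> i \<and> p j \<noteq> j\<close> by blast
        then have "M 0 $ j $ p j = 0" by (simp add: M0 mat_def)
        with j(1) show ?thesis by blast
      qed
      then have "(\<Prod>j\<in>UNIV - {i}. M 0 $ j $ p j) = 0" for i
        by (intro prod_zero) auto
      then show ?thesis by (simp only: D_def mult_zero_right sum.neutral_const)
    qed
    then have "(\<Sum>p\<in>?P. of_int (sign p) * D p) = (\<Sum>p\<in>{id}. of_int (sign p) * D p)"
      by (intro sum.mono_neutral_right) (auto simp: permutes_id finite_permutations)
    also have "\<dots> = trace A" by (simp add: D_def M0 mat_def trace_def)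
    finally show ?thesis .
  qed
  ultimately show ?thesis by simp
qed

text \<open>
  The determinant turns the group law into \<open>\<phi> (s + h) = \<phi> s * \<phi> h\<close>, so that the derivative of
  \<open>\<phi>\<close> at \<open>0\<close>, which is the trace, gives the differential equation \<open>\<phi>' = trace A * \<phi>\<close>.
\<close>

lemma det_matrix_exp: "det (matrix_exp A s) = exp (s * trace A)"
proof -
  define \<phi> where "\<phi> s = det (matrix_exp A s)" for s
  have add: "\<phi> (s + h) = \<phi> s * \<phi> h" for s h
    by (simp add: \<phi>_def matrix_exp_add det_mul)
  have D0: "(\<phi> has_real_derivative trace A) (at 0)"
    unfolding \<phi>_def
    by (rule det_has_derivative_trace_at_identity)
      (use has_derivative_matrix_exp_component[of A _ _ 0] in \<open>simp_all add: matrix_exp_0\<close>)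
  have D: "(\<phi> has_real_derivative \<phi> s * trace A) (at s)" for s
  proof -
    have "((\<lambda>u. \<phi> s * \<phi> (u - s)) has_real_derivative \<phi> s * trace A) (at s)"
      using D0 DERIV_shift[of \<phi> "trace A" s "- s"] by (intro DERIV_cmult) simp
    moreover have "\<phi> s * \<phi> (u - s) = \<phi> u" for u using add[of s "u - s"] by simp
    ultimately show ?thesis by simp
  qed
  have "((\<lambda>u. \<phi> u * exp (- (u * trace A))) has_real_derivative 0) (at s)" for s
    by (rule derivative_eq_intros D refl | simp)+
  then have "\<phi> s * exp (- (s * trace A)) = \<phi> 0 * exp (- (0 * trace A))"
    by (intro DERIV_isconst_all) auto
  then show ?thesis
    by (simp add: \<phi>_def matrix_exp_0 exp_minus field_simps)
qed

text \<open>
  Let \<open>m > 0\<close> be the minimum of the quadratic form of \<open>A\<close> on the unit sphere. Along the backward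
  flow \<open>u s = exp (- s A) x\<close> the squared norm has derivative \<open>- 2 (u \<bullet> A u) \<le> - 2 m \<bar>u\<bar>\<^sup>2\<close>, so that
  \<open>w s = exp (2 m s) \<bar>u s\<bar>\<^sup>2\<close> does not increase and \<open>u\<close> decays exponentially.
\<close>

lemma matrix_exp_minus_vector_tendsto_0:
  assumes pos: "\<And>x. x \<noteq> 0 \<Longrightarrow> 0 < x \<bullet> (A *v x)"
  shows "((\<lambda>s. matrix_exp A (- s) *v x) \<longlongrightarrow> 0) at_top"
proof -
  have "\<exists>m>0. \<forall>x. m * (x \<bullet> x) \<le> x \<bullet> (A *v x)"
  proof -
    let ?S = "sphere (0 :: real^'a) 1"
    have "axis undefined 1 \<in> ?S" by (simp add: norm_axis_1)
    then have S: "?S \<noteq> {}" by blast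
    have cont: "continuous_on ?S (\<lambda>x. x \<bullet> (A *v x))"
      by (intro continuous_intros linear_continuous_on matrix_vector_mul_bounded_linear)
    obtain u where u: "u \<in> ?S" "\<And>y. y \<in> ?S \<Longrightarrow> u \<bullet> (A *v u) \<le> y \<bullet> (A *v y)"
      using continuous_attains_inf[OF compact_sphere S cont] by (elim bexE) (rule that, auto)
    have "u \<bullet> (A *v u) * (x \<bullet> x) \<le> x \<bullet> (A *v x)" for x
    proof (cases "x = 0")
      case False
      then have pos: "0 < norm x ^ 2" by simp
      have "u \<bullet> (A *v u) \<le> (x /\<^sub>R norm x) \<bullet> (A *v (x /\<^sub>R norm x))"
        using False by (intro u(2)) simp
      also have "\<dots> = (x \<bullet> (A *v x)) / norm x ^ 2"
        by (simp only: matrix_vector_mult_scaleR inner_scaleR_left inner_scaleR_right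
            power2_eq_square divide_inverse inverse_mult_distrib mult_ac)
      finally have "u \<bullet> (A *v u) * norm x ^ 2 \<le> x \<bullet> (A *v x)"
        by (simp only: pos_le_divide_eq[OF pos])
      then show ?thesis by (simp only: power2_norm_eq_inner)
    qed simp
    moreover have "0 < u \<bullet> (A *v u)" using u(1) by (intro pos) auto
    ultimately show ?thesis by blast
  qed
  then obtain m where m: "m > 0" "\<And>x. m * (x \<bullet> x) \<le> x \<bullet> (A *v x)" by blast
  define u where "u s = matrix_exp A (- s) *v x" for s
  have u': "((\<lambda>s. u s $ i) has_real_derivative - (A *v u s) $ i) (at s)" for s i
  proof -
    have "((\<lambda>s. matrix_exp A (- s) $ i $ j) has_real_derivative
        - (A ** matrix_exp A (- s)) $ i $ j) (at s)" for j
      using DERIV_chain2[OF has_derivative_matrix_exp_component DERIV_minus[OF DERIV_ident]] by auto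
    then have "((\<lambda>s. \<Sum>j\<in>UNIV. matrix_exp A (- s) $ i $ j * x $ j) has_real_derivative
        (\<Sum>j\<in>UNIV. - (A ** matrix_exp A (- s)) $ i $ j * x $ j)) (at s)"
      by (intro DERIV_sum DERIV_cmult_right)
    then show ?thesis
      by (simp add: u_def matrix_vector_mul_assoc sum_negf)
        (simp add: matrix_vector_mult_def)
  qed
  define w where "w s = exp (2 * m * s) * (u s \<bullet> u s)" for s
  have w': "(w has_real_derivative exp (2 * m * s) * (2 * (m * (u s \<bullet> u s) - u s \<bullet> (A *v u s)))) (at s)" for s
  proof -
    have "((\<lambda>s. \<Sum>i\<in>UNIV. u s $ i * u s $ i) has_real_derivative
        (\<Sum>i\<in>UNIV. - (2 * (u s $ i * (A *v u s) $ i)))) (at s)"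
      by (intro DERIV_sum) (rule derivative_eq_intros u' refl | simp)+
    then have "((\<lambda>s. u s \<bullet> u s) has_real_derivative - 2 * (u s \<bullet> (A *v u s))) (at s)"
      by (simp add: inner_vec_def sum_negf sum_distrib_left)
    then have "((\<lambda>s. exp (2 * m * s) * (u s \<bullet> u s)) has_real_derivative
        exp (2 * m * s) * (2 * m) * (u s \<bullet> u s) + - 2 * (u s \<bullet> (A *v u s)) * exp (2 * m * s)) (at s)"
      by (intro DERIV_mult) (auto intro!: derivative_eq_intros)
    then show ?thesis unfolding w_def by (rule DERIV_cong) (simp add: algebra_simps)
  qed
  have w'_le: "exp (2 * m * s) * (2 * (m * (u s \<bullet> u s) - u s \<bullet> (A *v u s))) \<le> 0" for s
    using m(2)[of "u s"] by (intro mult_nonneg_nonpos) auto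
  have decr: "\<exists>y. DERIV w s :> y \<and> y \<le> 0" for s
    by (rule exI, rule conjI, rule w', rule w'_le)
  have w0: "w s \<le> w 0" if "0 \<le> s" for s
    using that by (rule DERIV_nonpos_imp_nonincreasing) (rule decr)
  have bnd: "norm (u s) ^ 2 \<le> w 0 * exp (- (2 * m * s))" if "0 \<le> s" for s
  proof -
    have "norm (u s) ^ 2 = w s * exp (- (2 * m * s))"
      by (simp add: w_def exp_minus power2_norm_eq_inner)
    then show ?thesis using w0[OF that] by (simp add: mult_right_mono)
  qed
  have "filterlim (\<lambda>s. 2 * m * s) at_top at_top"
    using m(1) by (intro filterlim_tendsto_pos_mult_at_top[OF tendsto_const] filterlim_ident) simp
  then have "filterlim (\<lambda>s. - (2 * m * s)) at_bot at_top"
    by (simp only: filterlim_uminus_at_top)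
  then have "((\<lambda>s. exp (- (2 * m * s))) \<longlongrightarrow> 0) at_top"
    by (rule filterlim_compose[OF exp_at_bot])
  then have lim: "((\<lambda>s. w 0 * exp (- (2 * m * s))) \<longlongrightarrow> 0) at_top"
    by (rule tendsto_mult_right_zero)
  have ev: "\<forall>\<^sub>F s in at_top. norm (u s) ^ 2 \<le> w 0 * exp (- (2 * m * s))"
    by (rule eventually_mono[OF eventually_ge_at_top[of 0]]) (rule bnd)
  have "((\<lambda>s. norm (u s) ^ 2) \<longlongrightarrow> 0) at_top"
    by (rule tendsto_sandwich[OF _ ev tendsto_const lim]) simp
  then have "((\<lambda>s. sqrt (norm (u s) ^ 2)) \<longlongrightarrow> sqrt 0) at_top" by (rule tendsto_real_sqrt)
  then show ?thesis by (simp add: u_def tendsto_norm_zero_iff)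
qed

section \<open>Dilations and their shells\<close>

lemma power_matrix_mult:
  assumes "s > 0" "t > 0"
  shows "power_matrix (s * t) A = power_matrix s A ** power_matrix t A"
  using assms by (simp add: power_matrix_eq_matrix_exp ln_mult matrix_exp_add)

lemma power_matrix_1 [simp]: "power_matrix 1 A = mat 1"
  by (simp add: power_matrix_eq_matrix_exp matrix_exp_0)

lemma det_power_matrix: "t > 0 \<Longrightarrow> det (power_matrix t A) = t powr trace A"
  by (simp add: power_matrix_eq_matrix_exp det_matrix_exp powr_def mult.commute)

lemma power_matrix_mult_vector:
  assumes "s > 0" "t > 0"
  shows "power_matrix s A *v (power_matrix t A *v x) = power_matrix (s * t) A *v x"
  using assms by (simp add: power_matrix_mult matrix_vector_mul_assoc)

lemma power_matrix_vector_inverse: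
  assumes "s > 0" "t > 0" "s * t = 1"
  shows "power_matrix s A *v (power_matrix t A *v x) = x"
  using assms by (simp add: power_matrix_mult_vector)

text \<open>
  Positive definiteness of the exponent acts through this fact: repeated halving of the scale moves
  every point to the origin.
\<close>

lemma dilation_contracts:
  assumes "sym_pos_def A"
  shows "(\<lambda>n. power_matrix (1 / 2 ^ n) A *v x) \<longlonglongrightarrow> 0"
proof -
  have "filterlim (\<lambda>n. ln 2 * real n) at_top sequentially"
    by (intro filterlim_tendsto_pos_mult_at_top[OF tendsto_const] filterlim_real_sequentially) simp
  moreover have "((\<lambda>s. matrix_exp A (- s) *v x) \<longlongrightarrow> 0) at_top"
    using assms by (intro matrix_exp_minus_vector_tendsto_0) (simp add: sym_pos_def_def)
  ultimately have "(\<lambda>n. matrix_exp A (- (ln 2 * real n)) *v x) \<longlonglongrightarrow> 0"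
    by (rule filterlim_compose[rotated])
  moreover have "matrix_exp A (- (ln 2 * real n)) = power_matrix (1 / 2 ^ n) A" for n
    by (simp add: power_matrix_eq_matrix_exp ln_div ln_realpow mult.commute)
  ultimately show ?thesis by simp
qed

text \<open>
  The fundamental annulus of the dilation \<open>2\<^sup>A\<close>, between the sphere of radius \<open>\<delta>\<close> and its
  image under \<open>2\<^sup>A\<close>. Both boundaries are included, at the price of overlaps between consecutive
  dilates, because uniform convergence is known on compact sets.
\<close>

definition dilation_shell :: "real \<Rightarrow> real^'d^'d \<Rightarrow> (real^'d) set" where
  "dilation_shell \<delta> A = {y. \<delta> \<le> norm y \<and> norm (power_matrix (1 / 2) A *v y) \<le> \<delta>}"

text \<open>
  Bounded because a point of the shell is the image under \<open>2\<^sup>A\<close> of a point in the ball of radius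
  \<open>\<delta>\<close>.
\<close>

lemma compact_dilation_shell: "compact (dilation_shell \<delta> A)"
proof -
  obtain K where K: "\<And>x. norm (power_matrix 2 A *v x) \<le> norm x * K"
    using bounded_linear.bounded[OF matrix_vector_mul_bounded_linear[of "power_matrix 2 A"]] by blast
  have "norm y \<le> \<delta> * \<bar>K\<bar>" if "y \<in> dilation_shell \<delta> A" for y
  proof -
    have "norm y = norm (power_matrix 2 A *v (power_matrix (1 / 2) A *v y))"
      by (simp add: power_matrix_vector_inverse)
    also have "\<dots> \<le> norm (power_matrix (1 / 2) A *v y) * K" by (rule K)
    also have "\<dots> \<le> norm (power_matrix (1 / 2) A *v y) * \<bar>K\<bar>" by (intro mult_left_mono) auto
    also have "\<dots> \<le> \<delta> * \<bar>K\<bar>"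
      using that by (intro mult_right_mono) (auto simp: dilation_shell_def)
    finally show ?thesis .
  qed
  then have "bounded (dilation_shell \<delta> A)" by (auto simp: bounded_iff)
  moreover have "closed (dilation_shell \<delta> A)"
    unfolding dilation_shell_def
    by (intro closed_Collect_conj closed_Collect_le continuous_intros linear_continuous_on
        matrix_vector_mul_bounded_linear)
  ultimately show ?thesis by (simp add: compact_eq_bounded_closed)
qed

text \<open>
  Scale \<open>x\<close> down by successive halvings. Just before the first step at which its norm falls below
  \<open>\<delta>\<close>, the scaled point lies in the shell. The norm need not decrease monotonically along the
  way.
\<close>

lemma dilated_shells_cover:
  assumes A: "sym_pos_def A" and \<delta>: "\<delta> > 0" and x: "\<delta> \<le> norm x"
  shows "\<exists>n. x \<in> (*v) (power_matrix (2 ^ n) A) ` dilation_shell \<delta> A"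
proof -
  define u where "u n = power_matrix (1 / 2 ^ n) A *v x" for n :: nat
  define n where "n = (LEAST n. norm (u n) < \<delta>)"
  have "(\<lambda>n. norm (u n)) \<longlonglongrightarrow> 0"
    using tendsto_norm[OF dilation_contracts[OF A]] by (simp add: u_def)
  then have "\<forall>\<^sub>F n in sequentially. norm (u n) < \<delta>"
    using \<delta> by (rule order_tendstoD(2))
  then obtain m where "norm (u m) < \<delta>"
    by (auto simp: eventually_sequentially)
  then have n: "norm (u n) < \<delta>" and least: "\<And>k. k < n \<Longrightarrow> \<not> norm (u k) < \<delta>"
    unfolding n_def by (rule LeastI) (rule not_less_Least)
  from n x obtain k where k: "n = Suc k"
    by (cases n) (auto simp: u_def)
  have "power_matrix (1 / 2) A *v u k = u (Suc k)"
    by (simp add: u_def power_matrix_mult_vector)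
  then have "u k \<in> dilation_shell \<delta> A"
    using n least[of k] k by (simp add: dilation_shell_def)
  moreover have "x = power_matrix (2 ^ k) A *v u k"
    by (simp add: u_def power_matrix_vector_inverse)
  ultimately show ?thesis by blast
qed

text \<open>
  This makes series over the dilated shells finite sums at each point. It holds since \<open>x\<close>, scaled down
  by a large power of two, has norm below \<open>\<delta>\<close> and so lies outside the shell.
\<close>

lemma dilated_shells_locally_finite:
  assumes A: "sym_pos_def A" and \<delta>: "\<delta> > 0"
  shows "finite {n. x \<in> (*v) (power_matrix (2 ^ n) A) ` dilation_shell \<delta> A}"
proof -
  have "(\<lambda>n. norm (power_matrix (1 / 2 ^ n) A *v x)) \<longlonglongrightarrow> 0"
    using tendsto_norm[OF dilation_contracts[OF A]] by simp
  then have "\<forall>\<^sub>F n in sequentially. norm (power_matrix (1 / 2 ^ n) A *v x) < \<delta>"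
    using \<delta> by (rule order_tendstoD(2))
  then obtain m where m: "\<And>n. n \<ge> m \<Longrightarrow> norm (power_matrix (1 / 2 ^ n) A *v x) < \<delta>"
    by (auto simp: eventually_sequentially)
  have "n < m" if "x \<in> (*v) (power_matrix (2 ^ n) A) ` dilation_shell \<delta> A" for n
  proof -
    from that obtain y where y: "x = power_matrix (2 ^ n) A *v y" "\<delta> \<le> norm y"
      by (auto simp: dilation_shell_def)
    have "power_matrix (1 / 2 ^ n) A *v x = y"
      by (simp add: y(1) power_matrix_vector_inverse)
    with m[of n] y(2) show ?thesis by fastforce
  qed
  then have "{n. x \<in> (*v) (power_matrix (2 ^ n) A) ` dilation_shell \<delta> A} \<subseteq> {..<m}"
    unfolding subset_iff mem_Collect_eq lessThan_iff by (intro allI impI)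
  then show ?thesis by (rule finite_subset) simp
qed

section \<open>Comparison of norms\<close>

lemma is_norm_upper_bound:
  fixes N :: "real^'d \<Rightarrow> real"
  assumes N: "is_norm N"
  shows "\<exists>c>0. \<forall>x. N x \<le> c * norm x"
proof -
  have nonneg: "0 \<le> N x" and scale: "N (a *\<^sub>R x) = \<bar>a\<bar> * N x"
    and tri: "N (x + y) \<le> N x + N y" and zero: "N 0 = 0" for x y a
    using N by (auto simp: is_norm_def)
  have sum: "N (\<Sum>i\<in>I. g i) \<le> (\<Sum>i\<in>I. N (g i))" if "finite I" for I and g :: "'d \<Rightarrow> real^'d"
    using that
  proof (induction I)
    case (insert i I)
    then show ?case using tri[of "g i" "\<Sum>i\<in>I. g i"] by simp
  qed (simp add: zero)
  define c where "c = (\<Sum>i\<in>UNIV. N (axis i 1)) + 1"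
  have "0 \<le> (\<Sum>i\<in>UNIV. N (axis i 1))" by (intro sum_nonneg nonneg)
  then have "c > 0" by (simp add: c_def)
  moreover have "N x \<le> c * norm x" for x
  proof -
    have "N x = N (\<Sum>i\<in>UNIV. x $ i *\<^sub>R axis i 1)"
      using basis_expansion[of x] by (simp add: scalar_mult_eq_scaleR)
    also have "\<dots> \<le> (\<Sum>i\<in>UNIV. N (x $ i *\<^sub>R axis i 1))" by (rule sum) simp
    also have "\<dots> \<le> (\<Sum>i\<in>UNIV. norm x * N (axis i 1))"
      unfolding scale by (intro sum_mono mult_right_mono component_le_norm_cart nonneg)
    also have "\<dots> \<le> c * norm x" by (simp add: c_def sum_distrib_left algebra_simps)
    finally show ?thesis .
  qed
  ultimately show ?thesis by blast
qed

text \<open>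
  The hypothesis of uniform convergence refers to sets \<open>{x. N x \<ge> \<epsilon>}\<close>, while the shells are
  defined by the Euclidean norm. This lemma and the preceding one translate between the two.
\<close>

lemma is_norm_bounded_below_on_compact:
  fixes N :: "real^'d \<Rightarrow> real"
  assumes N: "is_norm N" and C: "compact C" "0 \<notin> C"
  shows "\<exists>\<epsilon>>0. C \<subseteq> {x. \<epsilon> \<le> N x}"
proof (cases "C = {}")
  case True
  then show ?thesis by (auto intro: exI[of _ 1])
next
  case False
  obtain c where c: "c > 0" "\<And>x. N x \<le> c * norm x"
    using is_norm_upper_bound[OF N] by blast
  have tri: "N (x + y) \<le> N x + N y" and sym: "N (- x) = N x" for x y
    using N unfolding is_norm_def by (blast, metis abs_minus_cancel abs_one mult_1 scaleR_minus1_left)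
  have "dist (N x) (N y) \<le> c * dist x y" for x y
    using tri[of y "x - y"] tri[of x "y - x"] sym[of "x - y"] c(2)[of "x - y"]
    by (simp add: dist_norm)
  then have "c-lipschitz_on C N"
    using c(1) by (intro lipschitz_onI) auto
  then obtain x where x: "x \<in> C" "\<And>y. y \<in> C \<Longrightarrow> N x \<le> N y"
    using continuous_attains_inf[OF C(1) False] lipschitz_on_continuous_on by blast
  have "x \<noteq> 0" using x(1) C(2) by blast
  then have "N x > 0" using N unfolding is_norm_def by (metis less_le)
  then show ?thesis using x(2) by blast
qed

section \<open>Domination of the rescaled densities\<close>

text \<open>
  A weak form of Potter's bounds. As \<open>V (2 t) / V t\<close> tends to \<open>2 powr (- \<rho>) < 1\<close>, it is
  eventually below a fixed \<open>q < 1\<close>, and the bound at \<open>t\<close> can be iterated at \<open>2 t\<close>, \<open>4 t\<close> and so on,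
  with the same threshold for all steps.
\<close>

lemma regularly_varying_geometric_decay:
  assumes V: "V \<in> RV (- \<rho>)" and \<rho>: "\<rho> > 0"
  obtains q t\<^sub>0 where "0 < q" "q < 1" "t\<^sub>0 > 0"
    "\<And>t n. t \<ge> t\<^sub>0 \<Longrightarrow> 0 < V t \<and> V (2 ^ n * t) \<le> q ^ n * V t"
proof -
  (* any number strictly between the limit of the ratios and 1 *)
  define q where "q = (1 + 2 powr (- \<rho>)) / 2"
  have "2 powr (- \<rho>) < 1" using \<rho> by (simp add: powr_less_one)
  then have q: "2 powr (- \<rho>) < q" "0 < q" "q < 1" by (auto simp: q_def add_pos_pos)
  have "((\<lambda>t. V (t * 2) / V t) \<longlongrightarrow> 2 powr (- \<rho>)) at_top"
    using V by (auto simp: RV_def)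
  then have "\<forall>\<^sub>F t in at_top. V (t * 2) / V t < q"
    using q(1) by (rule order_tendstoD(2))
  moreover have "\<forall>\<^sub>F t in at_top. 0 < V t" using V by (simp add: RV_def)
  ultimately have "\<forall>\<^sub>F t in at_top. V (t * 2) / V t < q \<and> 0 < V t" by (rule eventually_conj)
  then obtain t1 where t1: "\<And>t. t \<ge> t1 \<Longrightarrow> V (t * 2) / V t < q \<and> 0 < V t"
    by (auto simp: eventually_at_top_linorder)
  have step: "V (s * 2) \<le> q * V s" if "s \<ge> t1" for s
    using t1[OF that] by (metis less_imp_le pos_divide_less_eq)
  (* positive, so that the scales 2 ^ n * t stay above the threshold t1 *)
  define t0 where "t0 = max t1 1"
  have t0: "t0 > 0" "t0 \<ge> t1" by (auto simp: t0_def)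
  have "0 < V t \<and> V (2 ^ n * t) \<le> q ^ n * V t" if t: "t \<ge> t0" for t n
  proof (induction n)
    case 0
    show ?case using t1[of t] t t0 by auto
  next
    case (Suc n)
    have "t * 1 \<le> t * 2 ^ n" using t t0 by (intro mult_left_mono) auto
    then have "t \<le> 2 ^ n * t" by (simp add: mult.commute)
    then have "2 ^ n * t \<ge> t1" using t t0 by linarith
    then have "V (2 ^ n * t * 2) \<le> q * V (2 ^ n * t)"
      by (rule step)
    also have "\<dots> \<le> q * (q ^ n * V t)" using Suc q by (intro mult_left_mono) auto
    finally show ?case using Suc by (simp add: mult_ac)
  qed
  with q t0 that show ?thesis by blast
qed

text \<open>
  The uniform limit controls the rescaled density only on compact sets. Scale invariance carries the
  control to infinity: the value at \<open>2\<^sup>n\<^sup>E y\<close> and scale \<open>t\<close> is the value at \<open>y\<close> and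
  scale \<open>2\<^sup>n t\<close>, up to the ratio of the normalising factors, which is
  \<open>(2 powr (- trace E)) ^ n * V (2 ^ n * t) / V t\<close>. The bound on \<open>C\<close> at all large scales and the
  geometric decay of \<open>V\<close> thus give a bound at every \<open>n\<close> that is uniform in \<open>t\<close>.
\<close>

lemma rescaled_density_le_on_dilated_shells:
  fixes f lam :: "real^'d \<Rightarrow> real"
  assumes V: "V \<in> RV (- \<rho>)" and \<rho>: "\<rho> > 0"
    and lim: "uniform_limit C (\<lambda>t x. f (power_matrix t E *v x) / (t powr (- trace E) * V t)) lam at_top"
    and bdd: "bounded (lam ` C)"
  shows "\<exists>q K. 0 < q \<and> q < 1 \<and> 0 \<le> K \<and>
    (\<forall>\<^sub>F t in at_top. \<forall>n. \<forall>y\<in>C.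
       f (power_matrix t E *v (power_matrix (2 ^ n) E *v y)) / (t powr (- trace E) * V t)
         \<le> K * (q * 2 powr (- trace E)) ^ n)"
proof -
  define g where "g t x = f (power_matrix t E *v x) / (t powr (- trace E) * V t)" for t x
  obtain q t\<^sub>0 where q: "0 < q" "q < 1" and t\<^sub>0: "t\<^sub>0 > 0"
    and V: "\<And>t n. t \<ge> t\<^sub>0 \<Longrightarrow> 0 < V t \<and> V (2 ^ n * t) \<le> q ^ n * V t"
    using regularly_varying_geometric_decay[OF V \<rho>] by blast
  obtain L where L: "\<And>y. y \<in> C \<Longrightarrow> \<bar>lam y\<bar> \<le> L"
    using bdd by (auto simp: bounded_iff)
  have "\<forall>\<^sub>F t in at_top. \<forall>y\<in>C. dist (g t y) (lam y) < 1"
    using uniform_limitD[OF lim, of 1] by (simp add: g_def)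
  then obtain t1 where t1: "\<And>t y. t \<ge> t1 \<Longrightarrow> y \<in> C \<Longrightarrow> dist (g t y) (lam y) < 1"
    unfolding eventually_at_top_linorder by blast
  define K where "K = \<bar>L\<bar> + 1"
  have gK: "g t y \<le> K" if "t \<ge> t1" "y \<in> C" for t y
    using t1[OF that] L[OF that(2)] by (simp add: K_def dist_real_def)
  have bound: "g t (power_matrix (2 ^ n) E *v y) \<le> K * (q * 2 powr (- trace E)) ^ n"
    if t: "t \<ge> max t\<^sub>0 t1" and y: "y \<in> C" for t n y
  proof -
    have tpos: "t > 0" using t t\<^sub>0 by simp
    define s where "s = 2 ^ n * t"
    have spos: "s > 0" using tpos by (simp add: s_def)
    have "t * 1 \<le> t * 2 ^ n" using tpos by (intro mult_left_mono) auto
    then have ts: "t \<le> s" by (simp add: s_def mult.commute)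
    have Vt: "0 < V t" and Vs: "0 < V s" and Vst: "V s \<le> q ^ n * V t"
      using V[of t n] V[of s 0] t ts by (auto simp: s_def)
    have powr: "s powr (- trace E) = (2 powr (- trace E)) ^ n * t powr (- trace E)"
      using tpos by (simp add: s_def powr_mult powr_power powr_powr mult.commute flip: powr_realpow)
    define a where "a = (2 powr (- trace E)) ^ n"
    have a: "a > 0" by (simp add: a_def)
    have "g t (power_matrix (2 ^ n) E *v y) = f (power_matrix s E *v y) / (t powr (- trace E) * V t)"
      using tpos by (simp add: g_def power_matrix_mult_vector s_def mult.commute)
    also have "\<dots> = g s y * (a * (V s / V t))"
      using tpos a Vs Vt by (simp add: g_def powr a_def)
    also have "\<dots> \<le> K * (a * (V s / V t))"
      using gK[of s y] t ts y a Vs Vt by (intro mult_right_mono) auto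
    also have "\<dots> \<le> K * (a * q ^ n)"
      using Vst Vt a by (intro mult_left_mono) (auto simp: pos_divide_le_eq K_def)
    also have "\<dots> = K * (q * 2 powr (- trace E)) ^ n"
      by (simp add: a_def power_mult_distrib mult_ac)
    finally show ?thesis .
  qed
  have "\<forall>\<^sub>F t in at_top. \<forall>n. \<forall>y\<in>C. g t (power_matrix (2 ^ n) E *v y) \<le> K * (q * 2 powr (- trace E)) ^ n"
    by (rule eventually_mono[OF eventually_ge_at_top[of "max t\<^sub>0 t1"]]) (blast intro: bound)
  then show ?thesis using q unfolding g_def by (intro exI[of _ q] exI[of _ K]) (simp add: K_def)
qed

text \<open>
  The weight \<open>w\<close> is the sum over \<open>n\<close> of the bound on the \<open>n\<close>-th dilated shell times the indicator
  of that shell. The \<open>n\<close>-th shell has volume \<open>(2 powr trace E) ^ n\<close> times that of the first, which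
  cancels the factor \<open>2 powr (- trace E)\<close> in the bound, so that the integral of \<open>w\<close> is a convergent
  geometric series in \<open>q\<close>.
\<close>

lemma integrable_geometric_weight_on_dilated_shells:
  fixes E :: "real^'d^'d"
  assumes E: "sym_pos_def E" and \<delta>: "\<delta> > 0" and q: "0 < q" "q < 1" and K: "0 \<le> K"
  obtains w where "integrable lborel w" "\<And>x. 0 \<le> w x"
    "\<And>n x. x \<in> (*v) (power_matrix (2 ^ n) E) ` dilation_shell \<delta> E \<Longrightarrow>
       K * (q * 2 powr (- trace E)) ^ n \<le> w x"
proof -
  let ?C = "dilation_shell \<delta> E" and ?r = "q * 2 powr (- trace E)"
  define S where "S n = (*v) (power_matrix (2 ^ n) E) ` ?C" for n :: nat
  define h where "h n x = K * ?r ^ n * indicator (S n) x" for n x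
  define w where "w x = (\<Sum>n. h n x)" for x
  have r: "0 < ?r" using q by simp
  have h0: "0 \<le> h n x" for n x using K r by (simp add: h_def)
  have compact: "compact (S n)" for n
    unfolding S_def
    by (intro compact_continuous_image compact_dilation_shell linear_continuous_on
        matrix_vector_mul_bounded_linear)
  have fin: "finite {n. h n x \<noteq> 0}" for x
    by (rule finite_subset[OF _ dilated_shells_locally_finite[OF E \<delta>, of x]])
      (auto simp: h_def S_def indicator_def split: if_splits)
  have summable: "summable (\<lambda>n. h n x)" for x
    by (rule summable_finite[OF fin[of x]]) simp
  have vol: "emeasure lborel (S n) = ennreal ((2 powr trace E) ^ n * measure lborel ?C)" for n
  proof -
    have "((2::real) ^ n) powr trace E = (2 powr trace E) ^ n"
      by (simp add: powr_power powr_powr mult.commute flip: powr_realpow)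
    moreover have "emeasure lborel ?C = ennreal (measure lborel ?C)"
      using emeasure_compact_finite[OF compact_dilation_shell[of \<delta> E]]
      by (simp add: emeasure_eq_ennreal_measure)
    ultimately show ?thesis
      unfolding S_def by (subst emeasure_lborel_matrix_image)
        (auto simp: det_power_matrix borel_compact compact_dilation_shell ennreal_mult')
  qed
  have int_S: "integrable lborel (indicator (S n) :: _ \<Rightarrow> real)" for n
    using compact[of n] emeasure_compact_finite[OF compact[of n]]
    by (intro integrable_real_indicator) (auto simp: borel_compact)
  have "integrable lborel w"
    unfolding w_def
  proof (rule integrable_suminf)
    show "integrable lborel (h n)" for n
      unfolding h_def by (intro integrable_mult_right int_S)
    show "AE x in lborel. summable (\<lambda>n. norm (h n x))"
      using summable h0 by simp
    have "(LINT x|lborel. norm (h n x)) = K * measure lborel ?C * q ^ n" for n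
    proof -
      have "(LINT x|lborel. norm (h n x)) = (LINT x|lborel. K * ?r ^ n * indicator (S n) x)"
        using h0 by (simp add: h_def)
      also have "\<dots> = K * ?r ^ n * measure lborel (S n)"
        using borel_compact[OF compact[of n]] by simp
      also have "measure lborel (S n) = (2 powr trace E) ^ n * measure lborel ?C"
        using vol[of n] by (simp add: measure_def)
      also have "K * ?r ^ n * \<dots> = K * measure lborel ?C * (?r * 2 powr trace E) ^ n"
        by (simp add: power_mult_distrib mult_ac)
      also have "?r * 2 powr trace E = q" by (simp add: mult.assoc flip: powr_add)
      finally show ?thesis .
    qed
    then show "summable (\<lambda>n. LINT x|lborel. norm (h n x))"
      using q by (simp add: summable_mult)
  qed
  moreover have "0 \<le> w x" for x
    unfolding w_def by (intro suminf_nonneg summable h0)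
  moreover have "K * ?r ^ n \<le> w x" if "x \<in> (*v) (power_matrix (2 ^ n) E) ` ?C" for n x
  proof -
    have "h n x \<le> w x"
      unfolding w_def using sum_le_suminf[OF summable, of "{n}" x] h0 by simp
    then show ?thesis using that by (simp add: h_def S_def)
  qed
  ultimately show ?thesis by (rule that)
qed

section \<open>Convergence of the rescaled probabilities\<close>

theorem theorem2p4:
  fixes M :: "'a measure" and X :: "'a \<Rightarrow> real^'d"
    and F :: "(real^'d) measure"
    and N :: "real^'d \<Rightarrow> real"
    and E :: "real^'d^'d"
    and \<rho> :: real and V :: "real \<Rightarrow> real"
    and f lam :: "real^'d \<Rightarrow> real"
  assumes "prob_space M"
    and "X \<in> borel_measurable M"
    and "F = distr M borel X"
    and "is_norm N"
    and "sym_pos_def E"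
    and "\<rho> > 0"
    and "V \<in> RV (- \<rho>)"
    and "continuous_on {0<..} (\<lambda>t. t powr \<rho> * V t)"
    and "f \<in> borel_measurable borel"
    and "\<And>x. 0 \<le> f x"
    and "F = density lborel (\<lambda>x. ennreal (f x))"
    and "lam \<in> borel_measurable (restrict_space borel (- {0}))"
    and "\<And>x. x \<noteq> 0 \<Longrightarrow> 0 < lam x"
    and "locally_bounded_on (- {0}) lam"
    and "\<And>\<epsilon>. \<epsilon> > 0 \<Longrightarrow>
           locally_uniform_limit {x. N x \<ge> \<epsilon>}
             (\<lambda>t x. f (power_matrix t E *v x) / (t powr (- trace E) * V t)) lam at_top"
  shows "\<forall>\<epsilon>>0. \<forall>B \<in> sets borel. B \<subseteq> {x. N x \<ge> \<epsilon>} \<longrightarrow>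
           set_integrable lborel B lam \<and>
           ((\<lambda>t. \<P>(\<omega> in M. X \<omega> \<in> (\<lambda>x. power_matrix t E *v x) ` B) / V t)
              \<longlongrightarrow> (LINT x:B|lborel. lam x)) at_top"
proof (intro allI ballI impI)
  fix \<epsilon> :: real and B :: "(real^'d) set"
  assume \<epsilon>: "\<epsilon> > 0" and B: "B \<in> sets borel" and B_sub: "B \<subseteq> {x. N x \<ge> \<epsilon>}"
  define g where "g t x = f (power_matrix t E *v x) / (t powr (- trace E) * V t)" for t x
  have unif: "uniform_limit C g lam at_top" if C: "compact C" "0 \<notin> C" for C
  proof -
    obtain \<epsilon>' where "\<epsilon>' > 0" "C \<subseteq> {x. \<epsilon>' \<le> N x}"
      using is_norm_bounded_below_on_compact[OF \<open>is_norm N\<close> C] by blast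
    then show ?thesis
      using assms(15)[of \<epsilon>'] C(1) unfolding locally_uniform_limit_def g_def by blast
  qed
  have Vpos: "\<forall>\<^sub>F t in at_top. 0 < V t"
    using \<open>V \<in> RV (- \<rho>)\<close> by (simp add: RV_def)
  obtain c where c: "c > 0" "\<And>x. N x \<le> c * norm x"
    using is_norm_upper_bound[OF \<open>is_norm N\<close>] by blast
  (* by the upper bound on N, the points of B have Euclidean norm at least \<delta> *)
  define \<delta> where "\<delta> = \<epsilon> / c"
  have \<delta>: "\<delta> > 0" using \<epsilon> c(1) by (simp add: \<delta>_def)
  have B_norm: "\<delta> \<le> norm x" if "x \<in> B" for x
  proof -
    have "\<epsilon> \<le> c * norm x" using B_sub that c(2)[of x] by force
    then show ?thesis using c(1) by (simp add: \<delta>_def pos_divide_le_eq mult.commute)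
  qed
  then have B0: "0 \<notin> B" using \<delta> by force
  let ?C = "dilation_shell \<delta> E"
  have C: "compact ?C" "0 \<notin> ?C"
    using \<delta> by (simp_all add: compact_dilation_shell) (simp add: dilation_shell_def)
  have "bounded (lam ` ?C)"
    using \<open>locally_bounded_on (- {0}) lam\<close> C unfolding locally_bounded_on_def by blast
  from rescaled_density_le_on_dilated_shells[OF \<open>V \<in> RV (- \<rho>)\<close> \<open>\<rho> > 0\<close> unif[OF C, unfolded g_def] this]
  obtain q K where q: "0 < q" "q < 1" and K: "0 \<le> K" and g_le:
      "\<forall>\<^sub>F t in at_top. \<forall>n. \<forall>y\<in>?C.
         g t (power_matrix (2 ^ n) E *v y) \<le> K * (q * 2 powr (- trace E)) ^ n"
    unfolding g_def by blast
  obtain w where w: "integrable lborel w" "\<And>x. 0 \<le> w x"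
      "\<And>n x. x \<in> (*v) (power_matrix (2 ^ n) E) ` ?C \<Longrightarrow> K * (q * 2 powr (- trace E)) ^ n \<le> w x"
    using integrable_geometric_weight_on_dilated_shells[OF \<open>sym_pos_def E\<close> \<delta> q K] by blast
  have dom: "\<forall>\<^sub>F t in at_top. AE x in lborel. norm (indicator B x *\<^sub>R g t x) \<le> w x"
    using g_le Vpos
  proof eventually_elim
    fix t assume g_le: "\<forall>n. \<forall>y\<in>?C. g t (power_matrix (2 ^ n) E *v y) \<le> K * (q * 2 powr (- trace E)) ^ n"
      and Vt: "0 < V t"
    have "norm (indicator B x *\<^sub>R g t x) \<le> w x" for x
    proof (cases "x \<in> B")
      case True
      have "0 \<le> g t x" using assms(10) Vt by (simp add: g_def)
      obtain n where n: "x \<in> (*v) (power_matrix (2 ^ n) E) ` ?C"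
        using dilated_shells_cover[OF \<open>sym_pos_def E\<close> \<delta> B_norm[OF True]] by blast
      then have "g t x \<le> K * (q * 2 powr (- trace E)) ^ n" using g_le by blast
      also have "\<dots> \<le> w x" by (rule w(3)[OF n])
      finally show ?thesis using True \<open>0 \<le> g t x\<close> by simp
    qed (simp add: w(2))
    then show "AE x in lborel. norm (indicator B x *\<^sub>R g t x) \<le> w x" by simp
  qed
  have ptw: "AE x in lborel. ((\<lambda>t. indicator B x *\<^sub>R g t x) \<longlongrightarrow> indicator B x *\<^sub>R lam x) at_top"
  proof (rule AE_I2)
    fix x
    show "((\<lambda>t. indicator B x *\<^sub>R g t x) \<longlongrightarrow> indicator B x *\<^sub>R lam x) at_top"
    proof (cases "x \<in> B")
      case True
      then have "uniform_limit {x} g lam at_top" using B0 by (intro unif) auto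
      then have "((\<lambda>t. g t x) \<longlongrightarrow> lam x) at_top" by (rule tendsto_uniform_limitI) simp
      then show ?thesis by (intro tendsto_scaleR tendsto_const)
    qed simp
  qed
  have meas_g: "(\<lambda>x. indicator B x *\<^sub>R g t x) \<in> borel_measurable lborel" for t
  proof -
    have "(\<lambda>x. f (power_matrix t E *v x)) \<in> borel_measurable borel"
      by (rule measurable_compose[OF measurable_matrix_vector_mult assms(9)])
    then show ?thesis using B unfolding g_def by simp
  qed
  have meas_lam: "(\<lambda>x. indicator B x *\<^sub>R lam x) \<in> borel_measurable lborel"
  proof -
    have "(\<lambda>x. indicator (- {0}) x *\<^sub>R lam x) \<in> borel_measurable borel"
      using assms(12) by (subst borel_measurable_restrict_space_iff[symmetric]) auto
    then have "(\<lambda>x. indicator B x *\<^sub>R (indicator (- {0}) x *\<^sub>R lam x)) \<in> borel_measurable borel"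
      by (rule borel_measurable_scaleR[OF borel_measurable_indicator[OF B]])
    moreover have "indicator B x *\<^sub>R (indicator (- {0}) x *\<^sub>R lam x) = indicator B x *\<^sub>R lam x" for x
      using B0 by (auto simp: indicator_def)
    ultimately show ?thesis unfolding measurable_lborel2 by (simp only:)
  qed
  have "set_integrable lborel B lam"
    unfolding set_integrable_def
    by (rule integrable_dominated_convergence_at_top[OF meas_lam meas_g w(1) ptw dom])
  moreover have "((\<lambda>t. LINT x:B|lborel. g t x) \<longlongrightarrow> (LINT x:B|lborel. lam x)) at_top"
    unfolding set_lebesgue_integral_def
    by (rule integral_dominated_convergence_at_top[OF meas_lam meas_g w(1) ptw dom])
  moreover have "\<forall>\<^sub>F t in at_top. (LINT x:B|lborel. g t x)
      = \<P>(\<omega> in M. X \<omega> \<in> (\<lambda>x. power_matrix t E *v x) ` B) / V t"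
    using Vpos eventually_gt_at_top[of 0]
  proof eventually_elim
    fix t :: real assume Vt: "0 < V t" and t: "0 < t"
    let ?A = "power_matrix t E"
    have det: "det ?A = t powr trace E" using t by (rule det_power_matrix)
    have AB: "(*v) ?A ` B \<in> sets borel"
      using det t B by (intro sets_borel_matrix_image) auto
    have "\<P>(\<omega> in M. X \<omega> \<in> (*v) ?A ` B) = measure F ((*v) ?A ` B)"
      using AB assms(2) unfolding assms(3)
      by (simp add: measure_distr vimage_def Int_def conj_commute)
    also have "\<dots> = t powr trace E * (LINT x:B|lborel. f (?A *v x))"
      unfolding assms(11) using measure_density_matrix_image[OF _ assms(9,10) B, of ?A] det t by simp
    also have "\<dots> / V t = (LINT x:B|lborel. g t x)"
      by (simp add: g_def powr_minus divide_inverse mult_ac)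
    finally show "(LINT x:B|lborel. g t x) = \<P>(\<omega> in M. X \<omega> \<in> (*v) ?A ` B) / V t" by simp
  qed
  ultimately show "set_integrable lborel B lam \<and>
      ((\<lambda>t. \<P>(\<omega> in M. X \<omega> \<in> (\<lambda>x. power_matrix t E *v x) ` B) / V t)
        \<longlongrightarrow> (LINT x:B|lborel. lam x)) at_top"
    by (blast intro: Lim_transform_eventually)
qed

end
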